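(* Every non-trivial perfect group which is finite or finitely generated solvable has weight $1$.
   Context: A group $G$ is perfect if its abelianisation $G/G'$ is trivial. The weight of a group $G$ is the smallest integer $n$ such that $G$ is the normal closure of $n$ of its elements, with the trivial group having weight $0$. *)

theory Defs
  imports "HOL-Algebra.Algebra" "HOL-Library.Extended_Nat"
begin

definition abelianisation :: "('a, 'b) monoid_scheme \<Rightarrow> 'a set monoid"
  where "abelianisation G = G Mod (derived G (carrier G))"

definition perfect_group :: "('a, 'b) monoid_scheme \<Rightarrow> bool"
  where "perfect_group G \<longleftrightarrow> group G \<and> trivial_group (abelianisation G)"

definition finitely_generated_group :: "('a, 'b) monoid_scheme \<Rightarrow> bool"
  where "finitely_generated_group G \<longleftrightarrow>
    group G \<and> (\<exists>S. finite S \<and> S \<subseteq> carrier G \<and> generate G S = carrier G)"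

definition normal_closure :: "('a, 'b) monoid_scheme \<Rightarrow> 'a set \<Rightarrow> 'a set"
  where "normal_closure G S = \<Inter>{N. N \<lhd> G \<and> S \<subseteq> N}"

(* The infimum is attained unless no finite set normally generates G, in which case the
   weight is \<infinity>. *)
definition group_weight :: "('a, 'b) monoid_scheme \<Rightarrow> enat"
  where "group_weight G =
    Inf {enat (card S) | S. finite S \<and> S \<subseteq> carrier G \<and> normal_closure G S = carrier G}"

(* The convention for the trivial group needs no separate clause: take S = {}. *)
lemma group_weight_trivial:
  assumes "trivial_group G"
  shows "group_weight G = 0"
proof -
  interpret group G using assms by (simp add: trivial_group_def)
  have c: "carrier G = {\<one>\<^bsub>G\<^esub>}" using assms by (simp add: trivial_group_def)
  have "carrier G \<lhd> G" by (rule normal_self)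
  moreover have "carrier G \<subseteq> N" if "N \<lhd> G" for N
    using that c by (simp add: normal_imp_subgroup subgroup.one_closed)
  ultimately have "normal_closure G {} = carrier G"
    unfolding normal_closure_def by blast
  then have "enat (card ({} :: 'a set)) \<in>
      {enat (card S) | S. finite S \<and> S \<subseteq> carrier G \<and> normal_closure G S = carrier G}"
    by blast
  then have "group_weight G \<le> enat (card ({} :: 'a set))"
    unfolding group_weight_def by (rule Inf_lower)
  then show ?thesis by (simp add: zero_enat_def [symmetric])
qed

end

theory Submission
  imports Defs
begin

text \<open>
  The maximal normal subgroups of a perfect group \<open>G\<close> behave like prime ideals, with commutators
  in the role of products. If normal subgroups \<open>A\<close> and \<open>B\<close> both escape a maximal normal subgroup
  \<open>M\<close>, then \<open>MA = MB = G\<close>, so modulo \<open>M\<close> every commutator of \<open>G\<close> equals some \<open>[a, b]\<close> with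
  \<open>a \<in> A\<close> and \<open>b \<in> B\<close>. These lie in \<open>A \<inter> B\<close>; were \<open>A \<inter> B\<close> contained in \<open>M\<close>, the quotient \<open>G/M\<close>
  would be abelian, which is impossible when \<open>G\<close> is perfect (\<open>maximal_normal_prime\<close>).

  Prime avoidance then applies as in commutative algebra: finitely many maximal normal subgroups
  never cover \<open>G\<close> (\<open>maximal_normal_avoidance\<close>). In a finite group there are only finitely many of
  them and every proper normal subgroup lies in one, so an element outside all of them has normal
  closure \<open>G\<close>. Hence the weight is at most 1, and it is 0 only for the trivial group.

  A solvable perfect group is trivial, because its derived series is constant and yet reaches the
  trivial subgroup (\<open>perfect_solvable_trivial\<close>). So a non-trivial group as in the theorem is finite.
\<close>

definition maximal_normal_subgroup :: "('a, 'b) monoid_scheme \<Rightarrow> 'a set \<Rightarrow> bool"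
  where "maximal_normal_subgroup G M \<longleftrightarrow>
    M \<lhd> G \<and> M \<noteq> carrier G \<and> (\<forall>N. N \<lhd> G \<longrightarrow> M \<subseteq> N \<longrightarrow> N = M \<or> N = carrier G)"

lemma perfect_group_derived_eq:
  assumes "perfect_group G"
  shows "derived G (carrier G) = carrier G"
proof -
  interpret group G using assms by (simp add: perfect_group_def)
  interpret D: normal "derived G (carrier G)" G by (rule derived_self_is_normal)
  have triv: "carrier (G Mod derived G (carrier G)) = {derived G (carrier G)}"
    using assms by (simp add: perfect_group_def abelianisation_def trivial_group_def FactGroup_def)
  have "x \<in> derived G (carrier G)" if x: "x \<in> carrier G" for x
  proof -
    have "derived G (carrier G) #>\<^bsub>G\<^esub> x = derived G (carrier G)"
      using triv x by (auto simp: FactGroup_def RCOSETS_def)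
    then show ?thesis
      using rcos_self[OF x D.subgroup_axioms] by simp
  qed
  then show ?thesis
    using D.subset by blast
qed

lemma perfect_solvable_trivial:
  assumes "perfect_group G" and "solvable G"
  shows "trivial_group G"
proof -
  interpret group G using assms by (simp add: perfect_group_def)
  obtain n where n: "(derived G ^^ n) (carrier G) = {\<one>\<^bsub>G\<^esub>}"
    using assms(2) solvable_iff_trivial_derived_seq by blast
  have "(derived G ^^ n) (carrier G) = carrier G"
    by (induction n) (simp_all add: perfect_group_derived_eq[OF assms(1)])
  then show ?thesis
    using n by (simp add: trivial_group_def is_group)
qed

text \<open>The product is a normal subgroup strictly above \<open>M\<close>, which leaves only \<open>G\<close>.\<close>

lemma maximal_normal_set_mult:
  assumes "maximal_normal_subgroup G M" and "A \<lhd> G" and "\<not> A \<subseteq> M"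
  shows "M <#>\<^bsub>G\<^esub> A = carrier G"
proof -
  interpret A: normal A G by fact
  interpret M: normal M G using assms(1) by (simp add: maximal_normal_subgroup_def)
  have "M <#>\<^bsub>G\<^esub> A \<lhd> G"
    using M.normal_axioms assms(2) by (rule A.normal_subgroup_set_mult_closed)
  moreover have "M \<subseteq> M <#>\<^bsub>G\<^esub> A"
  proof
    fix m assume m: "m \<in> M"
    then have "m \<otimes>\<^bsub>G\<^esub> \<one>\<^bsub>G\<^esub> \<in> M <#>\<^bsub>G\<^esub> A"
      unfolding set_mult_def using subgroup.one_closed[OF A.subgroup_axioms] by blast
    then show "m \<in> M <#>\<^bsub>G\<^esub> A"
      using m M.mem_carrier by simp
  qed
  moreover have "A \<subseteq> M <#>\<^bsub>G\<^esub> A"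
  proof
    fix a assume a: "a \<in> A"
    then have "\<one>\<^bsub>G\<^esub> \<otimes>\<^bsub>G\<^esub> a \<in> M <#>\<^bsub>G\<^esub> A"
      unfolding set_mult_def using subgroup.one_closed[OF M.subgroup_axioms] by blast
    then show "a \<in> M <#>\<^bsub>G\<^esub> A"
      using a A.mem_carrier by simp
  qed
  ultimately show ?thesis
    using assms(1,3) unfolding maximal_normal_subgroup_def by metis
qed

text \<open>
  The statement uses \<open>A \<inter> B\<close> in place of the commutator subgroup of \<open>A\<close> and \<open>B\<close>: it contains the
  latter, and avoidance needs to find elements in intersections.
\<close>

lemma maximal_normal_prime:
  assumes perf: "perfect_group G" and max: "maximal_normal_subgroup G M"
    and A: "A \<lhd> G" and B: "B \<lhd> G" and AB: "A \<inter> B \<subseteq> M"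
  shows "A \<subseteq> M \<or> B \<subseteq> M"
proof (rule ccontr)
  assume "\<not> (A \<subseteq> M \<or> B \<subseteq> M)"
  then have MA: "M <#>\<^bsub>G\<^esub> A = carrier G" and MB: "M <#>\<^bsub>G\<^esub> B = carrier G"
    using maximal_normal_set_mult[OF max] A B by blast+
  interpret A: normal A G by fact
  interpret B: normal B G by fact
  interpret M: normal M G using max by (simp add: maximal_normal_subgroup_def)
  have rep: "\<exists>c\<in>C. M #>\<^bsub>G\<^esub> g = M #>\<^bsub>G\<^esub> c"
    if C: "C \<subseteq> carrier G" "M <#>\<^bsub>G\<^esub> C = carrier G" and g: "g \<in> carrier G" for C g
  proof -
    have "g \<in> M <#>\<^bsub>G\<^esub> C"
      using C(2) g by simp
    then obtain m c where mc: "m \<in> M" "c \<in> C" "g = m \<otimes>\<^bsub>G\<^esub> c"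
      by (auto simp: set_mult_def)
    then have "M #>\<^bsub>G\<^esub> g = (M #>\<^bsub>G\<^esub> m) #>\<^bsub>G\<^esub> c"
      using C(1) M.subset by (auto simp: A.coset_mult_assoc)
    also have "M #>\<^bsub>G\<^esub> m = M"
      using mc(1) by (simp add: M.rcos_const)
    finally show ?thesis
      using mc(2) by blast
  qed
  have comm: "M #>\<^bsub>G\<^esub> (a \<otimes>\<^bsub>G\<^esub> b) = M #>\<^bsub>G\<^esub> (b \<otimes>\<^bsub>G\<^esub> a)" if a: "a \<in> A" and b: "b \<in> B" for a b
  proof -
    have c: "a \<in> carrier G" "b \<in> carrier G"
      using a b A.subset B.subset by auto
    have "a \<otimes>\<^bsub>G\<^esub> (b \<otimes>\<^bsub>G\<^esub> inv\<^bsub>G\<^esub> a \<otimes>\<^bsub>G\<^esub> inv\<^bsub>G\<^esub> b) \<in> A"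
      using a c by (simp add: A.inv_op_closed2 subgroup.m_closed[OF A.subgroup_axioms])
    moreover have "(a \<otimes>\<^bsub>G\<^esub> b \<otimes>\<^bsub>G\<^esub> inv\<^bsub>G\<^esub> a) \<otimes>\<^bsub>G\<^esub> inv\<^bsub>G\<^esub> b \<in> B"
      using b c by (simp add: B.inv_op_closed2 subgroup.m_closed[OF B.subgroup_axioms])
    ultimately have "(a \<otimes>\<^bsub>G\<^esub> b) \<otimes>\<^bsub>G\<^esub> inv\<^bsub>G\<^esub> (b \<otimes>\<^bsub>G\<^esub> a) \<in> M"
      using AB c by (auto simp: A.m_assoc A.inv_mult_group)
    then have "M #>\<^bsub>G\<^esub> ((a \<otimes>\<^bsub>G\<^esub> b) \<otimes>\<^bsub>G\<^esub> inv\<^bsub>G\<^esub> (b \<otimes>\<^bsub>G\<^esub> a)) = M"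
      by (simp add: M.rcos_const)
    then show ?thesis
      using c M.subset by (intro A.coset_mult_inv1) auto
  qed
  have "comm_group (G Mod M)"
  proof (rule group.group_comm_groupI[OF M.factorgroup_is_group])
    fix U V assume "U \<in> carrier (G Mod M)" "V \<in> carrier (G Mod M)"
    then obtain g h where g: "g \<in> carrier G" "U = M #>\<^bsub>G\<^esub> g" and h: "h \<in> carrier G" "V = M #>\<^bsub>G\<^esub> h"
      by (auto simp: FactGroup_def RCOSETS_def)
    obtain a b where a: "a \<in> A" "U = M #>\<^bsub>G\<^esub> a" and b: "b \<in> B" "V = M #>\<^bsub>G\<^esub> b"
      using rep[OF A.subset MA g(1)] rep[OF B.subset MB h(1)] g(2) h(2) by blast
    then show "U \<otimes>\<^bsub>G Mod M\<^esub> V = V \<otimes>\<^bsub>G Mod M\<^esub> U"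
      using comm[OF a(1) b(1)] A.subset B.subset by (auto simp: FactGroup_def M.rcos_sum)
  qed
  then have "carrier G \<subseteq> M"
    using A.derived_minimal[OF M.normal_axioms] perfect_group_derived_eq[OF perf] by simp
  then show False
    using max M.subset by (auto simp: maximal_normal_subgroup_def)
qed

text \<open>Intersecting with \<open>carrier G\<close> gives the empty family the right intersection.\<close>

lemma maximal_normal_prime_Inter:
  assumes perf: "perfect_group G" and max: "maximal_normal_subgroup G M"
    and "finite F" and "\<And>N. N \<in> F \<Longrightarrow> N \<lhd> G \<and> \<not> N \<subseteq> M"
  shows "carrier G \<inter> \<Inter>F \<lhd> G \<and> \<not> carrier G \<inter> \<Inter>F \<subseteq> M"
  using assms(3,4)
proof (induction F rule: finite_induct)
  case empty
  interpret group G using perf by (simp add: perfect_group_def)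
  have "M \<lhd> G" "M \<noteq> carrier G"
    using max by (auto simp: maximal_normal_subgroup_def)
  then show ?case
    using normal_self normal_imp_subgroup subgroup.subset by fastforce
next
  case (insert N F)
  interpret group G using perf by (simp add: perfect_group_def)
  let ?K = "carrier G \<inter> \<Inter>F"
  have K: "?K \<lhd> G" "\<not> ?K \<subseteq> M" and N: "N \<lhd> G" "\<not> N \<subseteq> M"
    using insert by auto
  then have "N \<inter> ?K \<lhd> G" "\<not> N \<inter> ?K \<subseteq> M"
    using normal_subgroup_intersect maximal_normal_prime[OF perf max] by blast+
  moreover have "N \<inter> ?K = carrier G \<inter> \<Inter>(insert N F)"
    by blast
  ultimately show ?case
    by simp
qed

text \<open>
  Distinct maximal normal subgroups are incomparable, so the previous lemma applies to each of them
  against the others.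
\<close>

lemma maximal_normal_avoidance:
  assumes perf: "perfect_group G"
    and "finite F" and "\<And>N. N \<in> F \<Longrightarrow> maximal_normal_subgroup G N"
  shows "\<exists>x\<in>carrier G. \<forall>N\<in>F. x \<notin> N"
  using assms(2,3)
proof (induction F rule: finite_induct)
  case empty
  interpret group G using perf by (simp add: perfect_group_def)
  show ?case by auto
next
  case (insert M F)
  interpret group G using perf by (simp add: perfect_group_def)
  have max: "maximal_normal_subgroup G M"
    using insert.prems by simp
  then interpret M: normal M G by (simp add: maximal_normal_subgroup_def)
  have F: "maximal_normal_subgroup G N" if "N \<in> F" for N
    using insert.prems that by simp
  obtain x where x: "x \<in> carrier G" "\<forall>N\<in>F. x \<notin> N"
    using insert.IH F by blast
  show ?case
  proof (cases "x \<in> M")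
    case False
    then show ?thesis using x by auto
  next
    case True
    have "N \<lhd> G \<and> \<not> N \<subseteq> M" if "N \<in> F" for N
      using F[OF that] max insert.hyps(2) that unfolding maximal_normal_subgroup_def by metis
    then obtain y where y: "y \<in> carrier G" "\<forall>N\<in>F. y \<in> N" "y \<notin> M"
      using maximal_normal_prime_Inter[OF perf max insert.hyps(1)] by blast
    \<comment> \<open>Multiplying by \<open>y\<close> moves \<open>x\<close> out of \<open>M\<close> and keeps its coset modulo every member of \<open>F\<close>.\<close>
    have "x \<otimes>\<^bsub>G\<^esub> y \<notin> N" if N: "N \<in> F" for N
    proof
      assume xy: "x \<otimes>\<^bsub>G\<^esub> y \<in> N"
      interpret N: normal N G using F[OF N] by (simp add: maximal_normal_subgroup_def)
      have "(x \<otimes>\<^bsub>G\<^esub> y) \<otimes>\<^bsub>G\<^esub> inv\<^bsub>G\<^esub> y \<in> N"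
        using xy y(2) N by blast
      then show False
        using x y(1) N by (simp add: m_assoc)
    qed
    moreover have "x \<otimes>\<^bsub>G\<^esub> y \<notin> M"
    proof
      assume "x \<otimes>\<^bsub>G\<^esub> y \<in> M"
      then have "inv\<^bsub>G\<^esub> x \<otimes>\<^bsub>G\<^esub> (x \<otimes>\<^bsub>G\<^esub> y) \<in> M"
        using True by blast
      then show False
        using x(1) y(1,3) by (simp add: m_assoc[symmetric])
    qed
    ultimately show ?thesis
      using x(1) y(1) by (intro bexI[of _ "x \<otimes>\<^bsub>G\<^esub> y"]) auto
  qed
qed

lemma finite_proper_normal_le_maximal:
  assumes fin: "finite (carrier G)" and N: "N \<lhd> G" "N \<noteq> carrier G"
  shows "\<exists>M. maximal_normal_subgroup G M \<and> N \<subseteq> M"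
proof -
  let ?P = "{K. K \<lhd> G \<and> K \<noteq> carrier G}"
  have "?P \<subseteq> Pow (carrier G)"
    using normal_imp_subgroup subgroup.subset by blast
  then have "finite ?P"
    using fin finite_subset by blast
  then obtain M where "M \<in> ?P" "N \<subseteq> M" "\<forall>K\<in>?P. M \<subseteq> K \<longrightarrow> M = K"
    using finite_has_maximal2[of ?P N] N by auto
  then show ?thesis
    unfolding maximal_normal_subgroup_def by blast
qed

lemma finite_perfect_normal_closure_singleton:
  assumes perf: "perfect_group G" and fin: "finite (carrier G)"
  shows "\<exists>x\<in>carrier G. normal_closure G {x} = carrier G"
proof -
  interpret group G using perf by (simp add: perfect_group_def)
  let ?F = "{M. maximal_normal_subgroup G M}"
  have "?F \<subseteq> Pow (carrier G)"
    using normal_imp_subgroup subgroup.subset by (fastforce simp: maximal_normal_subgroup_def)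
  then have "finite ?F"
    using fin finite_subset by blast
  then obtain x where x: "x \<in> carrier G" "\<forall>M\<in>?F. x \<notin> M"
    using maximal_normal_avoidance[OF perf] by blast
  have "N = carrier G" if "N \<lhd> G" "x \<in> N" for N
    using finite_proper_normal_le_maximal[OF fin that(1)] that(2) x(2) by blast
  then have eq: "{N. N \<lhd> G \<and> {x} \<subseteq> N} = {carrier G}"
    using normal_self x(1) by blast
  have "normal_closure G {x} = carrier G"
    unfolding normal_closure_def eq by simp
  then show ?thesis
    using x(1) by blast
qed

lemma group_weight_ge_one:
  assumes "group G" and "\<not> trivial_group G"
  shows "1 \<le> group_weight G"
proof -
  interpret group G by fact
  have "normal_closure G {} \<subseteq> {\<one>\<^bsub>G\<^esub>}"
    using one_is_normal by (auto simp: normal_closure_def)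
  then have "normal_closure G {} \<noteq> carrier G"
    using assms(2) trivial_group_subset by auto
  then have "1 \<le> enat (card S)" if "finite S" "normal_closure G S = carrier G" for S
    using that by (cases "S = {}") (auto simp: one_enat_def Suc_le_eq card_gt_0_iff)
  then show ?thesis
    unfolding group_weight_def by (intro Inf_greatest) auto
qed

theorem corollary5p18:
  fixes G :: "('a, 'b) monoid_scheme"
  assumes "perfect_group G"
    and "\<not> trivial_group G"
    and "finite (carrier G) \<or> (finitely_generated_group G \<and> solvable G)"
  shows "group_weight G = 1"
proof (rule antisym)
  have "finite (carrier G)"
    using assms perfect_solvable_trivial by blast
  then obtain x where "x \<in> carrier G" "normal_closure G {x} = carrier G"
    using finite_perfect_normal_closure_singleton assms(1) by blast
  then have "group_weight G \<le> enat (card {x})"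
    unfolding group_weight_def by (intro Inf_lower) blast
  then show "group_weight G \<le> 1"
    by (simp add: one_enat_def)
  show "1 \<le> group_weight G"
    using assms(1,2) by (intro group_weight_ge_one) (simp_all add: perfect_group_def)
qed

end
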